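(* Let $G$ and $H$ be two graphs of orders $n$ and $m$, respectively. Then $D'(G+H)\leq D'(K_{n,m})+1$.
   Context: The join $G+H$ of graphs on disjoint vertex sets has as edges all edges of $G$, all edges of $H$, and all pairs with one end in $V(G)$ and the other in $V(H)$. $K_{n,m}$ is the complete bipartite graph with parts of sizes $n$ and $m$. The distinguishing index $D'(X)$ of a graph $X$ is the least $d$ such that $X$ has an edge colouring with $d$ colours preserved by no non-identity automorphism of $X$. *)

theory Defs
  imports Main "HOL-Library.Extended_Nat"
begin

record 'a ugraph =
  verts :: "'a set"
  edges :: "'a set set"

definition simple_graph :: "'a ugraph \<Rightarrow> bool" where
  "simple_graph G \<longleftrightarrow>
     finite (verts G) \<and>
     (\<forall>e\<in>edges G. \<exists>u\<in>verts G. \<exists>v\<in>verts G. u \<noteq> v \<and> e = {u, v})"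

(* Meant for graphs with disjoint vertex sets only. *)
definition graph_join :: "'a ugraph \<Rightarrow> 'a ugraph \<Rightarrow> 'a ugraph" where
  "graph_join G H =
     \<lparr>verts = verts G \<union> verts H,
      edges = edges G \<union> edges H \<union> {{u, v} | u v. u \<in> verts G \<and> v \<in> verts H}\<rparr>"

definition complete_bipartite :: "nat \<Rightarrow> nat \<Rightarrow> (nat + nat) ugraph" where
  "complete_bipartite n m =
     \<lparr>verts = Inl ` {..<n} \<union> Inr ` {..<m},
      edges = {{Inl i, Inr j} | i j. i < n \<and> j < m}\<rparr>"

(* Values of f outside the vertex set are irrelevant. *)
definition graph_automorphism :: "'a ugraph \<Rightarrow> ('a \<Rightarrow> 'a) \<Rightarrow> bool" where
  "graph_automorphism X f \<longleftrightarrow>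
     bij_betw f (verts X) (verts X) \<and>
     (\<forall>u\<in>verts X. \<forall>v\<in>verts X. {f u, f v} \<in> edges X \<longleftrightarrow> {u, v} \<in> edges X)"

(* Colourings need not be proper, and not all d colours need be used. *)
definition distinguishing_edge_colouring ::
    "'a ugraph \<Rightarrow> nat \<Rightarrow> ('a set \<Rightarrow> nat) \<Rightarrow> bool" where
  "distinguishing_edge_colouring X d c \<longleftrightarrow>
     (\<forall>e\<in>edges X. c e < d) \<and>
     (\<forall>f. graph_automorphism X f \<and> (\<forall>e\<in>edges X. c (f ` e) = c e) \<longrightarrow>
          (\<forall>v\<in>verts X. f v = v))"

(* The infimum of a nonempty set in enat is its least element. Graphs with no
   distinguishing edge colouring at all (e.g. the single edge, where swapping
   the two ends preserves every colouring) get the value infinity. *)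
definition distinguishing_index :: "'a ugraph \<Rightarrow> enat" where
  "distinguishing_index X =
     Inf {enat d | d. \<exists>c. distinguishing_edge_colouring X d c}"

end

(* Colour the edges between G and H as in an optimal colouring of K_{n,m} and all
   remaining edges with one extra colour.  A colour-preserving automorphism of the
   join then respects the extra colour, so it is a colour-preserving automorphism
   of the spanning subgraph K_{n,m}, hence the identity. *)
theory Submission
  imports Defs
begin

text \<open>Automorphisms and isomorphisms are specified on pairs of vertices; under this condition
  such statements reach every edge. It is weaker than \<open>simple_graph\<close>: the ends may
  coincide and finiteness is not demanded.\<close>

definition edges_between_verts :: "'a ugraph \<Rightarrow> bool" where
  "edges_between_verts X \<longleftrightarrow> (\<forall>e\<in>edges X. \<exists>u\<in>verts X. \<exists>v\<in>verts X. e = {u, v})"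

lemma distinguishing_index_leI:
  assumes "distinguishing_edge_colouring X d c"
  shows "distinguishing_index X \<le> enat d"
  unfolding distinguishing_index_def using assms by (blast intro: Inf_lower)

text \<open>In \<open>enat\<close> the infimum of the empty set is infinity, so a finite value means
  that some colouring exists; by well-ordering the infimum is then a member of the set.\<close>

lemma distinguishing_index_attained:
  assumes "distinguishing_index X = enat d"
  obtains c where "distinguishing_edge_colouring X d c"
proof -
  let ?S = "{enat d | d. \<exists>c. distinguishing_edge_colouring X d c}"
  have "?S \<noteq> {}"
    using assms unfolding distinguishing_index_def by (metis Inf_enat_def enat.distinct(1))
  then have "Inf ?S \<in> ?S"
    unfolding Inf_enat_def by (metis (no_types, lifting) LeastI ex_in_conv)
  with assms that show thesis
    unfolding distinguishing_index_def by auto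
qed

text \<open>The extra-colour argument works for any spanning subgraph \<open>X\<close> of
  \<open>Y\<close>. If the index of \<open>X\<close> is infinite, the bound is trivial.\<close>

lemma distinguishing_index_spanning_supergraph:
  assumes verts: "verts X = verts Y" and sub: "edges X \<subseteq> edges Y"
    and Y: "edges_between_verts Y"
  shows "distinguishing_index Y \<le> distinguishing_index X + 1"
proof (cases "distinguishing_index X")
  case (enat d)
  then obtain c where c: "distinguishing_edge_colouring X d c"
    by (rule distinguishing_index_attained)
  \<comment> \<open>The colour \<open>d\<close> is fresh because \<open>c\<close> takes only values
    below \<open>d\<close> on \<open>edges X\<close>; hence a \<open>c'\<close>-colour below
    \<open>d\<close> detects exactly the edges of \<open>X\<close>.\<close>
  define c' where "c' e = (if e \<in> edges X then c e else d)" for e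
  have c_less: "c e < d" if "e \<in> edges X" for e
    using c that by (auto simp: distinguishing_edge_colouring_def)
  have c'_less: "c' e < d \<longleftrightarrow> e \<in> edges X" for e
    using c_less by (auto simp: c'_def)
  have "distinguishing_edge_colouring Y (Suc d) c'"
    unfolding distinguishing_edge_colouring_def
  proof (intro conjI ballI allI impI; (elim conjE)?)
    show "c' e < Suc d" for e
      using c_less[of e] by (auto simp: c'_def)
  next
    fix f v
    assume f: "graph_automorphism Y f" and pres: "\<forall>e\<in>edges Y. c' (f ` e) = c' e"
      and v: "v \<in> verts Y"
    \<comment> \<open>For an edge of \<open>Y\<close> the preserved colour decides membership in
      \<open>edges X\<close>. A non-edge of \<open>Y\<close> is mapped to a non-edge of
      \<open>Y\<close>, and neither can be an edge of \<open>X\<close>.\<close>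
    have "{f x, f y} \<in> edges X \<longleftrightarrow> {x, y} \<in> edges X"
      if "x \<in> verts Y" "y \<in> verts Y" for x y
    proof (cases "{x, y} \<in> edges Y")
      case True
      then have "c' {f x, f y} = c' {x, y}"
        using pres by fastforce
      then show ?thesis
        using c'_less by metis
    next
      case False
      then show ?thesis
        using f that sub unfolding graph_automorphism_def by (meson subsetD)
    qed
    then have "graph_automorphism X f"
      using f verts by (auto simp: graph_automorphism_def)
    moreover have "c (f ` e) = c e" if e: "e \<in> edges X" for e
    proof -
      have "c' (f ` e) = c' e"
        using pres e sub by blast
      \<comment> \<open>\<open>c'\<close> agrees with \<open>c\<close> only on
        \<open>edges X\<close>, so the image must be known to lie there before colours under
        \<open>c\<close> can be compared.\<close>
      moreover from this have "f ` e \<in> edges X"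
        using c'_less e by metis
      ultimately show ?thesis
        using e by (simp add: c'_def)
    qed
    ultimately show "f v = v"
      using c v verts unfolding distinguishing_edge_colouring_def by blast
  qed
  from distinguishing_index_leI[OF this] show ?thesis
    by (simp add: enat one_enat_def)
qed simp

text \<open>An optimal colouring of \<open>X\<close> is transported to \<open>Y\<close> along the
  inverse of \<open>h\<close>. The two graphs may have different vertex types.\<close>

lemma distinguishing_index_iso_le:
  assumes h: "bij_betw h (verts X) (verts Y)"
    and iso: "\<And>u v. u \<in> verts X \<Longrightarrow> v \<in> verts X \<Longrightarrow>
      {h u, h v} \<in> edges Y \<longleftrightarrow> {u, v} \<in> edges X"
    and X: "edges_between_verts X" and Y: "edges_between_verts Y"
  shows "distinguishing_index Y \<le> distinguishing_index X"
proof (cases "distinguishing_index X")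
  case (enat d)
  then obtain c where c: "distinguishing_edge_colouring X d c"
    by (rule distinguishing_index_attained)
  define g where "g = the_inv_into (verts X) h"
  have g: "bij_betw g (verts Y) (verts X)"
    unfolding g_def using h by (rule bij_betw_the_inv_into)
  have gh: "g (h x) = x" if "x \<in> verts X" for x
    using h that by (simp add: g_def bij_betw_def the_inv_into_f_f)
  have hg: "h (g y) = y" if "y \<in> verts Y" for y
    using h that by (simp add: g_def bij_betw_def f_the_inv_into_f)
  have hV: "h x \<in> verts Y" if "x \<in> verts X" for x
    using h that by (rule bij_betwE[rule_format])
  have gV: "g y \<in> verts X" if "y \<in> verts Y" for y
    using g that by (rule bij_betwE[rule_format])
  have iso': "{g x, g y} \<in> edges X \<longleftrightarrow> {x, y} \<in> edges Y"
    if "x \<in> verts Y" "y \<in> verts Y" for x y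
    using iso[of "g x" "g y"] that by (simp add: gV hg)
  have "distinguishing_edge_colouring Y d (\<lambda>e. c (g ` e))"
    unfolding distinguishing_edge_colouring_def
  proof (intro conjI ballI allI impI; (elim conjE)?)
    fix e assume "e \<in> edges Y"
    moreover from this obtain x y where "x \<in> verts Y" "y \<in> verts Y" "e = {x, y}"
      using Y unfolding edges_between_verts_def by blast
    ultimately have "g ` e \<in> edges X"
      using iso' by simp
    then show "c (g ` e) < d"
      using c by (auto simp: distinguishing_edge_colouring_def)
  next
    fix f v
    assume f: "graph_automorphism Y f" and v: "v \<in> verts Y"
      and pres: "\<forall>e\<in>edges Y. c (g ` f ` e) = c (g ` e)"
    have fV: "f y \<in> verts Y" if "y \<in> verts Y" for y
      using f that unfolding graph_automorphism_def by (blast dest: bij_betwE)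
    \<comment> \<open>Conjugation by \<open>h\<close> turns a colour-preserving automorphism of
      \<open>Y\<close> into one of \<open>X\<close>, which must be the identity on
      \<open>verts X\<close>.\<close>
    let ?F = "g \<circ> (f \<circ> h)"
    have "bij_betw ?F (verts X) (verts X)"
      using h g f unfolding graph_automorphism_def by (blast intro: bij_betw_trans)
    moreover have "{?F x, ?F y} \<in> edges X \<longleftrightarrow> {x, y} \<in> edges X"
      if "x \<in> verts X" "y \<in> verts X" for x y
      using f that by (simp add: graph_automorphism_def iso iso' hV fV)
    ultimately have "graph_automorphism X ?F"
      by (simp add: graph_automorphism_def)
    moreover have "c (?F ` e) = c e" if e: "e \<in> edges X" for e
    proof -
      obtain x y where xy: "x \<in> verts X" "y \<in> verts X" "e = {x, y}"
        using X e unfolding edges_between_verts_def by blast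
      then have "{h x, h y} \<in> edges Y"
        using e iso by simp
      with pres have "c (g ` f ` {h x, h y}) = c (g ` {h x, h y})"
        by blast
      then show ?thesis
        using xy by (simp add: gh)
    qed
    ultimately have "?F (g v) = g v"
      \<comment> \<open>Since \<open>h (g v) = v\<close>, the equation \<open>?F (g v) = g v\<close>
        says \<open>g (f v) = g v\<close>; applying \<open>h\<close> yields the claim.\<close>
      using c gV[OF v] unfolding distinguishing_edge_colouring_def by blast
    then show "f v = v"
      using v fV hg by (metis comp_apply)
  qed
  then show ?thesis
    unfolding enat by (rule distinguishing_index_leI)
qed simp

text \<open>Enumerations of \<open>A\<close> and \<open>B\<close> glue to an isomorphism from the
  standard copy on \<open>nat + nat\<close>.\<close>

lemma distinguishing_index_bipartite_le:
  assumes fin: "finite A" "finite B" and disj: "A \<inter> B = {}"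
  shows "distinguishing_index \<lparr>verts = A \<union> B, edges = {{u, v} | u v. u \<in> A \<and> v \<in> B}\<rparr>
    \<le> distinguishing_index (complete_bipartite (card A) (card B))"
    (is "distinguishing_index ?Y \<le> distinguishing_index ?X")
proof -
  obtain a where a: "bij_betw a {..<card A} A"
    using ex_bij_betw_nat_finite[OF fin(1)] by (auto simp: atLeast0LessThan)
  obtain b where b: "bij_betw b {..<card B} B"
    using ex_bij_betw_nat_finite[OF fin(2)] by (auto simp: atLeast0LessThan)
  have aA: "a i \<in> A" if "i < card A" for i
    using a that by (auto dest: bij_betwE)
  have bB: "b j \<in> B" if "j < card B" for j
    using b that by (auto dest: bij_betwE)
  let ?h = "case_sum a b"
  show ?thesis
  proof (rule distinguishing_index_iso_le)
    have "bij_betw ?h (Inl ` {..<card A}) A" "bij_betw ?h (Inr ` {..<card B}) B"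
      using a b by (simp_all add: bij_betw_def inj_on_def image_image)
    then show "bij_betw ?h (verts ?X) (verts ?Y)"
      using disj by (simp add: complete_bipartite_def bij_betw_combine)
    fix u v assume "u \<in> verts ?X" "v \<in> verts ?X"
    \<comment> \<open>Disjointness matters when \<open>u\<close> and \<open>v\<close> are on the
      same side: their images then both lie in \<open>A\<close> or both in \<open>B\<close>, so they
      form no edge of \<open>?Y\<close>.\<close>
    then show "{?h u, ?h v} \<in> edges ?Y \<longleftrightarrow> {u, v} \<in> edges ?X"
      using aA bB disj
      by (cases u; cases v) (force simp: complete_bipartite_def doubleton_eq_iff)+
  next
    show "edges_between_verts ?X"
      unfolding edges_between_verts_def complete_bipartite_def by force
    show "edges_between_verts ?Y"
      unfolding edges_between_verts_def by auto
  qed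
qed

theorem theorem3p3:
  fixes G H :: "'a ugraph" and n m :: nat
  assumes "simple_graph G" and "simple_graph H"
    and "verts G \<inter> verts H = {}"
    and "card (verts G) = n" and "card (verts H) = m"
  shows "distinguishing_index (graph_join G H)
           \<le> distinguishing_index (complete_bipartite n m) + 1"
proof -
  \<comment> \<open>This copy of the complete bipartite graph lives on the vertices of the join
    itself, so that it is literally a spanning subgraph.\<close>
  let ?K = "\<lparr>verts = verts G \<union> verts H,
    edges = {{u, v} | u v. u \<in> verts G \<and> v \<in> verts H}\<rparr>"
  have "edges_between_verts (graph_join G H)"
    unfolding edges_between_verts_def
  proof
    fix e assume "e \<in> edges (graph_join G H)"
    then consider "e \<in> edges G" | "e \<in> edges H"
      | u v where "u \<in> verts G" "v \<in> verts H" "e = {u, v}"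
      by (auto simp: graph_join_def)
    then show "\<exists>u\<in>verts (graph_join G H). \<exists>v\<in>verts (graph_join G H). e = {u, v}"
    proof cases
      case 1
      then obtain u v where "u \<in> verts G" "v \<in> verts G" "e = {u, v}"
        using assms(1) unfolding simple_graph_def by blast
      then show ?thesis
        by (auto simp: graph_join_def)
    next
      case 2
      then obtain u v where "u \<in> verts H" "v \<in> verts H" "e = {u, v}"
        using assms(2) unfolding simple_graph_def by blast
      then show ?thesis
        by (auto simp: graph_join_def)
    next
      case 3
      then show ?thesis
        by (auto simp: graph_join_def)
    qed
  qed
  then have "distinguishing_index (graph_join G H) \<le> distinguishing_index ?K + 1"
    by (intro distinguishing_index_spanning_supergraph) (auto simp: graph_join_def)
  also have "\<dots> \<le> distinguishing_index (complete_bipartite n m) + 1"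
    using distinguishing_index_bipartite_le[of "verts G" "verts H"] assms
    by (intro add_right_mono) (simp add: simple_graph_def)
  finally show ?thesis .
qed

end
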